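(* Let $n\ge 1$, let $c_k,d_k\in\mathbb{R}$, and let $f(\lambda)=\lambda_1\cdots\lambda_n-\sum_{k=0}^{n-1}c_k\sigma_k(\lambda)$ and $g(\lambda)=\lambda_1\cdots\lambda_n-\sum_{k=0}^{n-1}d_k\sigma_k(\lambda)$ be two $\Upsilon$-stable general inverse $\sigma_k$ type multilinear polynomials on $\mathbb{R}^n$, with $\Upsilon$-stable connected components $\Gamma_f^n$ of $\{f>0\}$ and $\Gamma_g^n$ of $\{g>0\}$. Then $g\gtrdot f$ if and only if $\Gamma_g^n\subset\Gamma_f^n$.
   Context: $\sigma_k(\lambda)$ is the $k$-th elementary symmetric polynomial of $\lambda_1,\dots,\lambda_n$ ($\sigma_0=1$); $\Gamma_n=\{\lambda\in\mathbb{R}^n:\lambda_i>0\ \forall i\}$. A general inverse $\sigma_k$ type multilinear polynomial is one of the form $\lambda_1\cdots\lambda_n-\sum_{k=0}^{n-1}c_k\sigma_k(\lambda)$ with real $c_k$. A connected component of $\{f>0\}$ is $\Upsilon$-stable if it is contained in $q+\Gamma_n$ for some $q\in\mathbb{R}^n$; $f$ is called $\Upsilon$-stable if $\{f>0\}$ has such a component (it is then unique and is denoted $\Gamma_f^n$). The diagonal restriction of $f$ is $r_f(x)=f(x,\dots,x)=x^n-\sum_{k=0}^{n-1}c_k\binom{n}{k}x^k$. For $k\in\{0,\dots,n-1\}$ let $x_k$ be the largest real root of the $k$-th derivative $r_f^{(k)}$ and $y_k$ the largest real root of $r_g^{(k)}$. One writes $g\gtrdot f$ if $y_k\ge x_k$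 for all $k\in\{0,\dots,n-1\}$. The inclusion $\subset$ is not required to be proper. *)

theory Defs
  imports "HOL-Analysis.Analysis"
begin

definition elem_sym :: "nat \<Rightarrow> real ^ 'n \<Rightarrow> real" where
  "elem_sym k l = (\<Sum>S | S \<subseteq> (UNIV :: 'n set) \<and> card S = k. \<Prod>i\<in>S. l $ i)"

text \<open>Only the coefficients \<open>c k\<close> with \<open>k < CARD('n)\<close> matter.\<close>

definition inverse_sigma_poly :: "(nat \<Rightarrow> real) \<Rightarrow> real ^ 'n \<Rightarrow> real" where
  "inverse_sigma_poly c l = (\<Prod>i\<in>UNIV. l $ i) - (\<Sum>k<CARD('n). c k * elem_sym k l)"

definition pos_orthant :: "(real ^ 'n) set" where
  "pos_orthant = {l. \<forall>i. l $ i > 0}"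

definition upsilon_stable_component :: "(real ^ 'n \<Rightarrow> real) \<Rightarrow> (real ^ 'n) set \<Rightarrow> bool" where
  "upsilon_stable_component f C \<longleftrightarrow>
     C \<in> components {l. f l > 0} \<and> (\<exists>q. C \<subseteq> (+) q ` pos_orthant)"

definition diag_restriction :: "(real ^ 'n \<Rightarrow> real) \<Rightarrow> real \<Rightarrow> real" where
  "diag_restriction f x = f (\<chi> i. x)"

lemma diag_restriction_inverse_sigma_poly:
  "diag_restriction (inverse_sigma_poly c :: real ^ 'n \<Rightarrow> real) x =
     x ^ CARD('n) - (\<Sum>k<CARD('n). c k * real (CARD('n) choose k) * x ^ k)"
proof -
  have "elem_sym k ((\<chi> i. x) :: real ^ 'n) = real (CARD('n) choose k) * x ^ k" for k
  proof -
    have "elem_sym k ((\<chi> i. x) :: real ^ 'n) =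
        (\<Sum>S | S \<subseteq> (UNIV :: 'n set) \<and> card S = k. x ^ k)"
      unfolding elem_sym_def by (rule sum.cong) auto
    then show ?thesis
      using n_subsets[of "UNIV :: 'n set" k] by simp
  qed
  then show ?thesis
    by (simp add: diag_restriction_def inverse_sigma_poly_def mult.assoc)
qed

text \<open>The value is meaningful only if \<open>h\<close> has a largest root.  This holds for every derivative of
  order \<open>k < CARD('n)\<close> of the diagonal restriction of an \<open>\<Upsilon>\<close>-stable \<open>inverse_sigma_poly c\<close>.\<close>

definition largest_root :: "(real \<Rightarrow> real) \<Rightarrow> real" where
  "largest_root h = (GREATEST x. h x = 0)"

text \<open>The relation written $g \gtrdot f$, in this order of the arguments.\<close>

definition dominates :: "(real ^ 'n \<Rightarrow> real) \<Rightarrow> (real ^ 'n \<Rightarrow> real) \<Rightarrow> bool" where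
  "dominates g f \<longleftrightarrow>
     (\<forall>k<CARD('n). largest_root ((deriv ^^ k) (diag_restriction g))
                  \<ge> largest_root ((deriv ^^ k) (diag_restriction f)))"

end

theory Submission
  imports Defs
begin

text \<open>
  For a set \<open>V\<close> of coordinates let \<open>f\<^sub>V\<close> be the derivative of \<open>f\<close> with respect to all coordinates in
  \<open>V\<close>; it is again a symmetric multilinear polynomial in the remaining ones.  Let \<open>P\<^sub>V(f)\<close>, the
  cylinder, consist of the points that agree with some point of the stable component outside \<open>V\<close>, so
  that \<open>P\<close> at the empty set is the component itself and \<open>P\<close> at the full set is the whole space.

  The component is closed under increasing coordinates: if \<open>f\<close> did not increase in some coordinate, one
  could lower that coordinate without end inside the component, which is bounded below.  Consequently
  \<open>P\<^sub>V(f)\<close> behaves like a component of \<open>{f\<^sub>V > 0}\<close>: a segment along which \<open>f\<^sub>V > 0\<close> can be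
  lifted into \<open>{f > 0}\<close> by raising the coordinates in \<open>V\<close>, because \<open>f\<^sub>V\<close> is the leading
  coefficient there (\<open>compact_lift\<close>, \<open>segment_in_cylinder\<close>), and conversely \<open>f\<^sub>V > 0\<close> on
  \<open>P\<^sub>V(f)\<close> (\<open>cylinder_positive\<close>).  Since \<open>f\<^sub>V\<close> restricted to the diagonal is a positive multiple of
  the derivative of order \<open>k = card V\<close> of the diagonal restriction, the diagonal point with entries \<open>x\<close>
  lies in \<open>P\<^sub>V(f)\<close> exactly when \<open>x\<close> exceeds the largest root of that derivative
  (\<open>largest_root_threshold\<close>).

  An inclusion of the components passes to all cylinders, hence to their diagonal points, and this is
  the inequality of the largest roots.  For the converse one shows \<open>P\<^sub>V(g) \<subseteq> P\<^sub>V(f)\<close> by induction from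
  the full set downwards (\<open>cylinder_subset_step\<close>).  If the inclusion fails for \<open>V\<close> but holds for all
  larger sets, then \<open>f\<^sub>V\<close> vanishes at some point of \<open>P\<^sub>V(g)\<close>.  Among such points at which \<open>g\<^sub>V\<close> is not
  below some fixed positive value there is one whose coordinate sum is minimal.  If two of its
  coordinates outside \<open>V\<close> differ, then moving them together along the hyperbola \<open>f\<^sub>V = 0\<close> lowers the
  sum and does not lower \<open>g\<^sub>V\<close> (\<open>averaging_step\<close>), which is impossible.  So outside \<open>V\<close> it is
  a diagonal point in \<open>P\<^sub>V(g)\<close> at which \<open>f\<^sub>V\<close> vanishes, against the order of the largest roots.
\<close>

section \<open>Partial derivatives\<close>

text \<open>The derivative of \<open>inverse_sigma_poly c\<close> with respect to every coordinate in \<open>V\<close>, written as an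
  explicit multilinear polynomial in the coordinates outside \<open>V\<close>: differentiating \<open>\<sigma>\<^sub>k\<close> once in each
  coordinate of \<open>V\<close> lowers \<open>k\<close> by \<open>card V\<close>.\<close>

definition partial_deriv :: "(nat \<Rightarrow> real) \<Rightarrow> 'n set \<Rightarrow> real ^ 'n \<Rightarrow> real" where
  "partial_deriv c V l = (\<Sum>T\<in>Pow (- V).
     (if card T + card V = CARD('n) then 1 else - c (card T + card V)) * (\<Prod>i\<in>T. l $ i))"

lemma partial_deriv_empty:
  "partial_deriv c {} = (inverse_sigma_poly c :: real ^ 'n \<Rightarrow> real)"
proof
  fix l :: "real ^ 'n"
  let ?m = "\<lambda>T. \<Prod>i\<in>T. l $ i"
  let ?P = "{T :: 'n set. T \<noteq> UNIV}"
  have full: "card T = CARD('n) \<longleftrightarrow> T = UNIV" for T :: "'n set"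
    using card_subset_eq[of UNIV T] by auto
  have lt: "T \<noteq> UNIV \<Longrightarrow> card T < CARD('n)" for T :: "'n set"
    using psubset_card_mono[of UNIV T] by auto
  have "partial_deriv c {} l = (\<Sum>T\<in>insert UNIV ?P. (if T = UNIV then 1 else - c (card T)) * ?m T)"
    unfolding partial_deriv_def by (intro sum.cong) (auto simp: full)
  also have "\<dots> = ?m UNIV + (\<Sum>T\<in>?P. (if T = UNIV then 1 else - c (card T)) * ?m T)"
    by (subst sum.insert) auto
  also have "(\<Sum>T\<in>?P. (if T = UNIV then 1 else - c (card T)) * ?m T) = - (\<Sum>T\<in>?P. c (card T) * ?m T)"
    unfolding sum_negf[symmetric] by (intro sum.cong) auto
  also have "(\<Sum>T\<in>?P. c (card T) * ?m T)
      = (\<Sum>k<CARD('n). \<Sum>T | T \<in> ?P \<and> card T = k. c (card T) * ?m T)"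
    using lt by (intro sum.group[symmetric]) (simp_all add: image_subset_iff)
  also have "\<dots> = (\<Sum>k<CARD('n). c k * elem_sym k l)"
    unfolding elem_sym_def sum_distrib_left
    by (intro sum.cong refl) (auto simp: full)
  finally show "partial_deriv c {} l = inverse_sigma_poly c l"
    by (simp add: inverse_sigma_poly_def)
qed

text \<open>The sum below depends on \<open>V\<close> and \<open>i\<close> only through \<open>insert i V\<close> and \<open>card V\<close>; this is how the
  symmetry of the polynomial is used.\<close>

lemma partial_deriv_split:
  fixes l :: "real ^ 'n"
  assumes "i \<notin> V"
  shows "partial_deriv c V l = (\<Sum>T\<in>Pow (- insert i V).
      (if card T + card V = CARD('n) then 1 else - c (card T + card V)) * (\<Prod>i\<in>T. l $ i))
    + l $ i * partial_deriv c (insert i V) l"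
proof -
  let ?e = "\<lambda>k. if k = CARD('n) then 1 else - c k"
  have P: "Pow (- V) = Pow (- insert i V) \<union> insert i ` Pow (- insert i V)"
    using assms by (subst Pow_insert[symmetric]) (rule arg_cong[where f = Pow], auto)
  have "partial_deriv c V l = (\<Sum>T\<in>Pow (- insert i V). ?e (card T + card V) * (\<Prod>i\<in>T. l $ i))
      + (\<Sum>T\<in>insert i ` Pow (- insert i V). ?e (card T + card V) * (\<Prod>i\<in>T. l $ i))"
    unfolding partial_deriv_def P by (rule sum.union_disjoint) auto
  also have "(\<Sum>T\<in>insert i ` Pow (- insert i V). ?e (card T + card V) * (\<Prod>i\<in>T. l $ i))
      = (\<Sum>T\<in>Pow (- insert i V). ?e (card (insert i T) + card V) * (\<Prod>i\<in>insert i T. l $ i))"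
    by (rule sum.reindex[unfolded comp_def], rule inj_onI) auto
  also have "\<dots> = (\<Sum>T\<in>Pow (- insert i V). l $ i * (?e (card T + card (insert i V)) * (\<Prod>i\<in>T. l $ i)))"
  proof (rule sum.cong[OF refl])
    fix T assume "T \<in> Pow (- insert i V)"
    then have "i \<notin> T" by auto
    then show "?e (card (insert i T) + card V) * (\<Prod>i\<in>insert i T. l $ i)
        = l $ i * (?e (card T + card (insert i V)) * (\<Prod>i\<in>T. l $ i))"
      using assms by (simp add: card_insert_if)
  qed
  finally show ?thesis
    by (simp add: partial_deriv_def sum_distrib_left)
qed

lemma partial_deriv_cong:
  assumes "\<And>i. i \<notin> V \<Longrightarrow> l $ i = m $ i"
  shows "partial_deriv c V l = partial_deriv c V m"
  unfolding partial_deriv_def using assms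
  by (intro sum.cong refl arg_cong2[where f = "(*)"] prod.cong) auto

lemma partial_deriv_shift:
  fixes l :: "real ^ 'n"
  assumes "i \<notin> V"
  shows "partial_deriv c V (l + t *\<^sub>R axis i 1) = partial_deriv c V l + t * partial_deriv c (insert i V) l"
proof -
  have 1: "partial_deriv c (insert i V) (l + t *\<^sub>R axis i 1) = partial_deriv c (insert i V) l"
    by (rule partial_deriv_cong) (auto simp: axis_def)
  have 2: "(\<Sum>T\<in>Pow (- insert i V). e T * (\<Prod>k\<in>T. (l + t *\<^sub>R axis i 1) $ k))
      = (\<Sum>T\<in>Pow (- insert i V). e T * (\<Prod>k\<in>T. l $ k))" for e
    by (intro sum.cong refl arg_cong2[where f = "(*)"] prod.cong) (auto simp: axis_def)
  show ?thesis
    unfolding partial_deriv_split[OF assms, of c "l + t *\<^sub>R axis i 1"]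
      partial_deriv_split[OF assms, of c l] 1 2
    by (simp add: algebra_simps)
qed

text \<open>As a function of the coordinates \<open>s\<close> and \<open>t\<close> at \<open>i\<close> and \<open>j\<close>, the polynomial has by symmetry the
  form \<open>a s t + b (s + t) + e\<close>.  Both sides below are \<open>b\<close>, so the two asymptotes of the hyperbolas
  in this plane sit at the same height \<open>- b / a\<close>.\<close>

lemma partial_deriv_swap:
  fixes l :: "real ^ 'n"
  assumes "i \<noteq> j" "i \<notin> V" "j \<notin> V"
  shows "partial_deriv c (insert j V) l - l $ i * partial_deriv c (insert i (insert j V)) l
    = partial_deriv c (insert i V) l - l $ j * partial_deriv c (insert i (insert j V)) l"
  using partial_deriv_split[of i "insert j V" c l] partial_deriv_split[of j "insert i V" c l] assms
  by (simp add: insert_commute[of i j] cong: if_cong)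

lemma partial_deriv_shift2:
  fixes l :: "real ^ 'n"
  assumes "i \<noteq> j" "i \<notin> V" "j \<notin> V"
  shows "partial_deriv c V (l + x *\<^sub>R axis i 1 + y *\<^sub>R axis j 1) = partial_deriv c V l
    + x * partial_deriv c (insert i V) l + y * partial_deriv c (insert j V) l
    + x * y * partial_deriv c (insert i (insert j V)) l"
  using assms by (simp add: partial_deriv_shift insert_commute) (simp add: algebra_simps)

lemma continuous_on_partial_deriv [continuous_intros]:
  assumes "continuous_on S h"
  shows "continuous_on S (\<lambda>x. partial_deriv c V (h x :: real ^ 'n))"
  unfolding partial_deriv_def by (intro continuous_intros assms)

section \<open>The diagonal\<close>

abbreviation diag :: "real \<Rightarrow> real ^ 'n" where
  "diag x \<equiv> (\<chi> i. x)"

lemma has_derivative_partial_deriv_diag: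
  fixes V :: "'n::finite set"
  assumes "i \<notin> V"
  shows "((\<lambda>x. partial_deriv c V (diag x)) has_real_derivative
    real (CARD('n) - card V) * partial_deriv c (insert i V) (diag x)) (at x)"
proof -
  let ?e = "\<lambda>k. if k = CARD('n) then 1 else - c k"
  have D: "partial_deriv c W (diag x :: real ^ 'n)
      = (\<Sum>j\<le>CARD('n) - card W. real (CARD('n) - card W choose j) * ?e (j + card W) * x ^ j)"
    for W :: "'n set" and x
  proof -
    let ?m = "CARD('n) - card W"
    have m: "card (- W) = ?m" by (simp add: Compl_eq_Diff_UNIV card_Diff_subset)
    have "partial_deriv c W (diag x :: real ^ 'n) = (\<Sum>T\<in>Pow (- W). ?e (card T + card W) * x ^ card T)"
      by (simp add: partial_deriv_def)
    also have "\<dots> = (\<Sum>j\<le>?m. \<Sum>T | T \<in> Pow (- W) \<and> card T = j. ?e (card T + card W) * x ^ card T)"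
      by (rule sum.group[symmetric]) (auto simp: m[symmetric] intro: card_mono)
    also have "\<dots> = (\<Sum>j\<le>?m. \<Sum>T | T \<subseteq> - W \<and> card T = j. ?e (j + card W) * x ^ j)"
      by (intro sum.cong) auto
    also have "\<dots> = (\<Sum>j\<le>?m. real (?m choose j) * ?e (j + card W) * x ^ j)"
      using n_subsets[of "- W"] by (simp add: m mult.assoc)
    finally show ?thesis .
  qed
  obtain m where m: "CARD('n) - card V = Suc m"
    using assms psubset_card_mono[of UNIV V] by (cases "CARD('n) - card V") auto
  have m': "CARD('n) - card (insert i V) = m" using m assms by simp
  have "((\<lambda>x. partial_deriv c V (diag x)) has_real_derivative
      (\<Sum>j\<le>Suc m. real (Suc m choose j) * ?e (j + card V) * (real j * x ^ (j - Suc 0)))) (at x)"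
    unfolding D m by (intro DERIV_sum DERIV_cmult DERIV_pow)
  also have "(\<Sum>j\<le>Suc m. real (Suc m choose j) * ?e (j + card V) * (real j * x ^ (j - Suc 0)))
      = (\<Sum>j\<le>m. real (Suc m choose Suc j) * ?e (Suc j + card V) * (real (Suc j) * x ^ j))"
    by (subst sum.atMost_Suc_shift) simp
  also have "\<dots> = (\<Sum>j\<le>m. real (Suc m) * (real (m choose j) * ?e (j + card (insert i V)) * x ^ j))"
  proof (intro sum.cong refl)
    fix j
    have A: "real (Suc j) * real (Suc m choose Suc j) = real (Suc m) * real (m choose j)"
      by (simp only: of_nat_mult[symmetric] Suc_times_binomial)
    have B: "Suc j + card V = j + card (insert i V)" using assms by simp
    have "real (Suc m choose Suc j) * ?e (Suc j + card V) * (real (Suc j) * x ^ j)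
        = (real (Suc j) * real (Suc m choose Suc j)) * ?e (Suc j + card V) * x ^ j"
      by (simp only: mult_ac)
    also have "\<dots> = (real (Suc m) * real (m choose j)) * ?e (j + card (insert i V)) * x ^ j"
      by (simp only: A B)
    finally show "real (Suc m choose Suc j) * ?e (Suc j + card V) * (real (Suc j) * x ^ j)
        = real (Suc m) * (real (m choose j) * ?e (j + card (insert i V)) * x ^ j)"
      by (simp only: mult_ac)
  qed
  also have "\<dots> = real (CARD('n) - card V) * partial_deriv c (insert i V) (diag x)"
    unfolding D m m' sum_distrib_left[symmetric] ..
  finally show ?thesis .
qed

lemma higher_deriv_diag_restriction:
  fixes V :: "'n::finite set"
  shows "\<exists>r>0. (deriv ^^ card V) (diag_restriction (inverse_sigma_poly c :: real ^ 'n \<Rightarrow> real))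
    = (\<lambda>x. r * partial_deriv c V (diag x))"
proof (induction V rule: finite_induct[OF finite])
  case 1
  show ?case
    by (rule exI[of _ 1]) (simp add: partial_deriv_empty fun_eq_iff diag_restriction_def)
next
  case (2 i V)
  then obtain r where r: "r > 0" "(deriv ^^ card V) (diag_restriction (inverse_sigma_poly c :: real ^ 'n \<Rightarrow> real))
    = (\<lambda>x. r * partial_deriv c V (diag x))" by auto
  let ?s = "r * real (CARD('n) - card V)"
  have "card V < CARD('n)" using 2 psubset_card_mono[of UNIV V] by auto
  then have "?s > 0" using r by simp
  moreover have "deriv (\<lambda>x. r * partial_deriv c V (diag x)) x = ?s * partial_deriv c (insert i V) (diag x)" for x
    using DERIV_cmult[OF has_derivative_partial_deriv_diag[OF \<open>i \<notin> V\<close>, of c x], of r]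
    by (intro DERIV_imp_deriv) (simp add: mult.assoc)
  ultimately show ?case using 2 r by auto
qed

section \<open>A stable component and its projections\<close>

text \<open>The full preimage of the projection of \<open>C\<close> that forgets the coordinates in \<open>V\<close>.  Working with the
  preimage keeps all projections in the same space.\<close>

definition cylinder :: "(real ^ 'n) set \<Rightarrow> 'n set \<Rightarrow> (real ^ 'n) set" where
  "cylinder C V = {l. \<exists>m\<in>C. \<forall>i. i \<notin> V \<longrightarrow> m $ i = l $ i}"

lemma cylinder_empty [simp]: "cylinder C {} = C"
  by (auto simp: cylinder_def vec_eq_iff[symmetric])

lemma cylinder_mono: "V \<subseteq> W \<Longrightarrow> cylinder C V \<subseteq> cylinder C W"
  by (auto simp: cylinder_def)

lemma cylinder_cong:
  "l \<in> cylinder C V \<Longrightarrow> (\<And>i. i \<notin> V \<Longrightarrow> l $ i = m $ i) \<Longrightarrow> m \<in> cylinder C V"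
  by (auto simp: cylinder_def)

locale stable_component =
  fixes c :: "nat \<Rightarrow> real" and C :: "(real ^ 'n) set"
  assumes stable: "upsilon_stable_component (inverse_sigma_poly c) C"
begin

abbreviation D where "D \<equiv> partial_deriv c :: 'n set \<Rightarrow> real ^ 'n \<Rightarrow> real"

lemma component: "C \<in> components {l. D {} l > 0}"
  using stable by (simp add: upsilon_stable_component_def partial_deriv_empty)

lemma segment_in_component:
  assumes "a \<in> C" "\<And>x. x \<in> closed_segment a b \<Longrightarrow> D {} x > 0"
  shows "b \<in> C"
  using components_maximal[OF component, of "closed_segment a b"] assms by auto

lemma component_bounded_below: "\<exists>q. \<forall>l\<in>C. \<forall>i. q $ i < l $ i"
proof -
  obtain q where "C \<subseteq> (+) q ` pos_orthant"
    using stable by (auto simp: upsilon_stable_component_def)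
  then have "\<forall>l\<in>C. \<forall>i. q $ i < l $ i" by (fastforce simp: pos_orthant_def)
  then show ?thesis by blast
qed

text \<open>Along a coordinate line \<open>f\<close> is affine, hence it stays positive on the side where it does not
  decrease.  The lower side would leave every translate of the orthant, so \<open>f\<close> strictly increases.\<close>

lemma shift_in_component:
  assumes "p \<in> C" "t \<ge> 0"
  shows "p + t *\<^sub>R axis i 1 \<in> C"
proof -
  obtain q where q: "\<forall>l\<in>C. \<forall>i. q $ i < l $ i" using component_bounded_below by blast
  have fp: "D {} p > 0" using in_components_subset[OF component] assms by auto
  have seg: "p + s *\<^sub>R axis i 1 \<in> C" if "s * D {i} p \<ge> 0" for s
  proof (rule segment_in_component[OF \<open>p \<in> C\<close>])
    fix x assume "x \<in> closed_segment p (p + s *\<^sub>R axis i 1)"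
    then obtain u where u: "0 \<le> u" "x = p + (u * s) *\<^sub>R axis i 1"
      by (auto simp: in_segment algebra_simps)
    then show "D {} x > 0"
      using fp that by (simp add: partial_deriv_shift mult.assoc add_pos_nonneg)
  qed
  have "D {i} p > 0"
  proof (rule ccontr)
    assume "\<not> ?thesis"
    moreover have "q $ i - p $ i \<le> 0" using q assms by (simp add: less_imp_le)
    ultimately have "p + (q $ i - p $ i) *\<^sub>R axis i 1 \<in> C"
      by (intro seg) (simp add: mult_nonpos_nonpos)
    then show False using q by (auto dest!: bspec spec[of _ i] simp: axis_def)
  qed
  then show ?thesis using assms by (intro seg) simp
qed

lemma component_upward:
  assumes "p \<in> C" "\<And>i. p $ i \<le> l $ i"
  shows "l \<in> C"
proof -
  have "(\<chi> i. if i \<in> A then l $ i else p $ i) \<in> C" for A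
  proof (induction A rule: finite_induct[OF finite])
    case 1
    then show ?case using assms by (simp add: vec_eq_iff cong: if_cong)
  next
    case (2 j A)
    have "(\<chi> i. if i \<in> insert j A then l $ i else p $ i)
        = (\<chi> i. if i \<in> A then l $ i else p $ i) + (l $ j - p $ j) *\<^sub>R axis j 1"
      using 2(2) by (auto simp: vec_eq_iff axis_def)
    then show ?case using shift_in_component[OF 2(3)] assms(2)[of j] by simp
  qed
  from this[of UNIV] show ?thesis by (simp add: vec_eq_iff)
qed

lemma cylinder_insert:
  assumes "l \<in> cylinder C (insert i V)"
  obtains z where "0 \<le> z" "l + z *\<^sub>R axis i 1 \<in> cylinder C V"
proof -
  obtain m where m: "m \<in> C" "\<And>k. k \<notin> insert i V \<Longrightarrow> m $ k = l $ k"
    using assms by (auto simp: cylinder_def)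
  let ?z = "max 0 (m $ i - l $ i)"
  have "(\<chi> k. if k = i then max (l $ i) (m $ i) else m $ k) \<in> C"
    by (rule component_upward[OF m(1)]) auto
  then have "l + ?z *\<^sub>R axis i 1 \<in> cylinder C V"
    using m(2) unfolding cylinder_def
    by (intro CollectI bexI[where x = "\<chi> k. if k = i then max (l $ i) (m $ i) else m $ k"])
      (auto simp: axis_def)
  then show thesis using that[of ?z] by simp
qed

lemma cylinder_upward:
  assumes "p \<in> cylinder C V" "\<And>i. p $ i \<le> l $ i"
  shows "l \<in> cylinder C V"
proof -
  obtain m where m: "m \<in> C" "\<And>i. i \<notin> V \<Longrightarrow> m $ i = p $ i"
    using assms by (auto simp: cylinder_def)
  have "(\<chi> i. if i \<in> V then m $ i else l $ i) \<in> C"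
    using m assms(2) by (intro component_upward[OF m(1)]) auto
  then show ?thesis unfolding cylinder_def
    by (intro CollectI bexI[where x = "\<chi> i. if i \<in> V then m $ i else l $ i"]) auto
qed

lemma diag_in_cylinder: "\<exists>x. diag x \<in> cylinder C V"
proof -
  obtain p where p: "p \<in> C" using in_components_nonempty[OF component] by blast
  have "p $ i \<le> Max (range (($) p))" for i by simp
  then have "diag (Max (range (($) p))) \<in> cylinder C {}"
    using component_upward[OF p] by simp
  then show ?thesis using cylinder_mono[of "{}" V] by blast
qed

lemma cylinder_UNIV: "cylinder C UNIV = UNIV"
  using diag_in_cylinder cylinder_cong[of _ C UNIV] by blast

lemma cylinder_bounded_below: "\<exists>q. \<forall>V. \<forall>l\<in>cylinder C V. \<forall>i. i \<notin> V \<longrightarrow> q $ i < l $ i"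
proof -
  obtain q where q: "\<forall>l\<in>C. \<forall>i. q $ i < l $ i" using component_bounded_below by blast
  have "q $ i < l $ i" if l: "l \<in> cylinder C V" and i: "i \<notin> V" for V l i
  proof -
    obtain m where "m \<in> C" "m $ i = l $ i" using l i by (auto simp: cylinder_def)
    then show ?thesis using q by metis
  qed
  then show ?thesis by blast
qed

text \<open>Raising the coordinate \<open>v\<close> makes the term \<open>f\<^bsub>insert v V\<^esub>\<close> dominate \<open>f\<^sub>V\<close>, uniformly on a compact
  set; removing the elements of \<open>V\<close> one after the other reaches \<open>f\<close> itself.\<close>

lemma compact_lift:
  assumes "compact K" "\<And>x. x \<in> K \<Longrightarrow> D V x > 0"
  shows "\<exists>w. (\<forall>i. 0 \<le> w $ i) \<and> (\<forall>i. i \<notin> V \<longrightarrow> w $ i = 0) \<and> (\<forall>x\<in>K. D {} (x + w) > 0)"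
proof -
  have "finite V" by simp
  then show ?thesis using assms
  proof (induction V arbitrary: K)
    case empty
    then show ?case by (intro exI[of _ 0]) auto
  next
    case (insert v V)
    have "continuous_on K (\<lambda>x. D V x / D (insert v V) x)"
      using insert.prems(2) by (intro continuous_intros) (auto simp: less_imp_neq[symmetric])
    then have "bounded ((\<lambda>x. D V x / D (insert v V) x) ` K)"
      using insert.prems(1) compact_continuous_image compact_imp_bounded by blast
    then obtain B where B: "B > 0" "\<And>x. x \<in> K \<Longrightarrow> \<bar>D V x / D (insert v V) x\<bar> \<le> B"
      unfolding bounded_pos by auto
    let ?e = "(B + 1) *\<^sub>R axis v 1 :: real ^ 'n"
    have pos: "D V (x + ?e) > 0" if "x \<in> K" for x
    proof -
      have d: "D (insert v V) x > 0" using insert.prems that by blast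
      have "D V x / D (insert v V) x > - (B + 1)" using B(2)[OF that] by linarith
      then have "D V x > - (B + 1) * D (insert v V) x" using d by (simp add: pos_less_divide_eq)
      then show ?thesis using partial_deriv_shift[OF insert.hyps(2), of c x "B + 1"]
        by (simp add: algebra_simps)
    qed
    have "compact ((\<lambda>x. x + ?e) ` K)"
      using insert.prems(1) by (intro compact_continuous_image continuous_intros)
    from insert.IH[OF this] obtain w where
      w: "\<forall>i. 0 \<le> w $ i" "\<forall>i. i \<notin> V \<longrightarrow> w $ i = 0" "\<forall>x\<in>K. D {} (x + ?e + w) > 0"
      using pos by auto
    show ?case
      using w B(1) by (intro exI[of _ "?e + w"]) (auto simp: axis_def add.assoc)
  qed
qed

text \<open>The cylinder inherits from the component the property that positive segments do not leave it:
  such a segment is lifted to one in the component by large coordinates in \<open>V\<close>.\<close>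

lemma segment_in_cylinder:
  assumes "a \<in> cylinder C V" "\<And>x. x \<in> closed_segment a b \<Longrightarrow> D V x > 0"
  shows "b \<in> cylinder C V"
proof -
  obtain m where m: "m \<in> C" "\<And>i. i \<notin> V \<Longrightarrow> m $ i = a $ i"
    using assms(1) by (auto simp: cylinder_def)
  let ?d = "m - a"
  have tr: "closed_segment (a + e) (b + e) = (\<lambda>x. x + e) ` closed_segment a b" for e :: "real ^ 'n"
    using closed_segment_translation[of e a b] by (simp add: add.commute)
  have pos: "D V (x + ?d) > 0" if "x \<in> closed_segment a b" for x
    using assms(2)[OF that] m(2) partial_deriv_cong[of V "x + ?d" x c] by simp
  have "compact ((\<lambda>x. x + ?d) ` closed_segment a b)"
    by (intro compact_continuous_image continuous_intros compact_segment)
  then have "\<exists>w. (\<forall>i. 0 \<le> w $ i) \<and> (\<forall>i. i \<notin> V \<longrightarrow> w $ i = 0)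
      \<and> (\<forall>x\<in>(\<lambda>x. x + ?d) ` closed_segment a b. D {} (x + w) > 0)"
    by (rule compact_lift) (use pos in blast)
  then obtain w where w: "\<forall>i. 0 \<le> w $ i" "\<forall>i. i \<notin> V \<longrightarrow> w $ i = 0"
      "\<And>x. x \<in> closed_segment a b \<Longrightarrow> D {} (x + ?d + w) > 0"
    by blast
  have "m + w \<in> C" using m(1) w(1) by (intro component_upward[OF m(1)]) auto
  then have "a + (?d + w) \<in> C" by simp
  then have "b + (?d + w) \<in> C"
  proof (rule segment_in_component)
    fix x assume "x \<in> closed_segment (a + (?d + w)) (b + (?d + w))"
    then obtain y where "y \<in> closed_segment a b" "x = y + (?d + w)" unfolding tr by blast
    then show "D {} x > 0" using w(3)[of y] by (simp only: add.assoc)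
  qed
  moreover have "\<forall>i. i \<notin> V \<longrightarrow> (b + (?d + w)) $ i = b $ i" using m(2) w(2) by simp
  ultimately show ?thesis unfolding cylinder_def by blast
qed

text \<open>Induction on \<open>V\<close>.  If \<open>f\<^sub>V\<close> were nonincreasing in a coordinate \<open>v\<close> outside \<open>V\<close> at a point of the
  cylinder over \<open>V\<close>, the whole downward ray in direction \<open>v\<close> would stay in that cylinder, which is
  bounded below in the coordinate \<open>v\<close>.\<close>

lemma cylinder_positive: "l \<in> cylinder C V \<Longrightarrow> D V l > 0"
proof (induction V arbitrary: l rule: finite_induct[OF finite])
  case 1
  then show ?case using in_components_subset[OF component] by auto
next
  case (2 v V)
  obtain z where z: "l + z *\<^sub>R axis v 1 \<in> cylinder C V" using cylinder_insert[OF 2(4)] by blast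
  define p where "p = l + z *\<^sub>R axis v 1"
  obtain q where q: "\<forall>V. \<forall>l\<in>cylinder C V. \<forall>i. i \<notin> V \<longrightarrow> q $ i < l $ i"
    using cylinder_bounded_below by blast
  have pV: "p \<in> cylinder C V" using z p_def by simp
  have eq: "D (insert v V) l = D (insert v V) p"
    by (rule partial_deriv_cong) (auto simp: p_def axis_def)
  have qp: "q $ v - p $ v \<le> 0" using q pV 2(2) by (simp add: less_imp_le)
  show ?case
  proof (rule ccontr)
    assume neg: "\<not> ?thesis"
    have "p + (q $ v - p $ v) *\<^sub>R axis v 1 \<in> cylinder C V"
    proof (intro segment_in_cylinder[OF pV])
      fix x assume "x \<in> closed_segment p (p + (q $ v - p $ v) *\<^sub>R axis v 1)"
      then obtain u where u: "0 \<le> u" "x = p + (u * (q $ v - p $ v)) *\<^sub>R axis v 1"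
        by (auto simp: in_segment algebra_simps)
      have "u * (q $ v - p $ v) * D (insert v V) p \<ge> 0"
        using u qp neg eq by (intro mult_nonpos_nonpos mult_nonneg_nonpos) auto
      then show "D V x > 0"
        using 2(3)[OF pV] u(2) partial_deriv_shift[OF 2(2)] by simp
    qed
    then have "q $ v < (p + (q $ v - p $ v) *\<^sub>R axis v 1) $ v" using q 2(2) by blast
    then show False by (simp add: axis_def)
  qed
qed

lemma closed_Int_cylinder:
  assumes "closed N" "\<And>x. x \<in> N \<Longrightarrow> D V x > 0"
  shows "closed (N \<inter> cylinder C V)"
  unfolding closed_sequential_limits
proof (intro allI impI, elim conjE)
  fix x l assume x: "\<forall>n. x n \<in> N \<inter> cylinder C V" "x \<longlonglongrightarrow> l"
  then have lN: "l \<in> N" using assms(1) unfolding closed_sequential_limits by blast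
  have "open {y. D V y > 0}" by (intro open_Collect_less continuous_intros)
  then obtain e where e: "e > 0" "ball l e \<subseteq> {y. D V y > 0}"
    using assms(2)[OF lN] unfolding open_contains_ball by blast
  obtain n where "dist (x n) l < e"
    using metric_LIMSEQ_D[OF x(2) e(1)] by blast
  then have n: "x n \<in> ball l e" by (simp add: dist_commute)
  have "closed_segment (x n) l \<subseteq> ball l e"
    using n e(1) by (intro closed_segment_subset) simp_all
  then have "D V y > 0" if "y \<in> closed_segment (x n) l" for y using e(2) that by blast
  moreover have "x n \<in> cylinder C V" using x(1) by blast
  ultimately have "l \<in> cylinder C V" by (intro segment_in_cylinder[of "x n" V l])
  then show "l \<in> N \<inter> cylinder C V" using lN by simp
qed

lemma diag_segment_in_cylinder:
  assumes "diag x \<in> cylinder C V" "\<And>z. y \<le> z \<Longrightarrow> z \<le> x \<Longrightarrow> D V (diag z) > 0" "y \<le> x"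
  shows "diag y \<in> cylinder C V"
proof (rule segment_in_cylinder[OF assms(1)])
  fix p :: "real ^ 'n" assume "p \<in> closed_segment (diag x) (diag y)"
  then obtain u where u: "0 \<le> u" "u \<le> 1" "p = (1 - u) *\<^sub>R diag x + u *\<^sub>R diag y"
    by (auto simp: in_segment)
  have "0 \<le> (1 - u) * (x - y)" "0 \<le> u * (x - y)" using u assms(3) by simp_all
  then have "y \<le> (1 - u) * x + u * y" "(1 - u) * x + u * y \<le> x" by (simp_all add: algebra_simps)
  moreover have "p = diag ((1 - u) * x + u * y)" using u by (simp add: vec_eq_iff)
  ultimately show "D V p > 0" using assms(2) by auto
qed

text \<open>The diagonal points of the cylinder form an up-closed set that is bounded below because \<open>V\<close> is
  proper.  At its infimum \<open>b\<close> the polynomial \<open>f\<^sub>V\<close> vanishes: were it nonzero there, either the set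
  would extend below \<open>b\<close> or \<open>f\<^sub>V\<close> would be negative inside the cylinder.  Above \<open>b\<close> it is positive, so
  \<open>b\<close> is the largest root.\<close>

lemma largest_root_threshold:
  fixes V :: "'n set"
  assumes "V \<noteq> UNIV"
  defines "a \<equiv> largest_root ((deriv ^^ card V) (diag_restriction (inverse_sigma_poly c :: real ^ 'n \<Rightarrow> real)))"
  shows "diag x \<in> cylinder C V \<longleftrightarrow> a < x" and "D V (diag a) = 0"
proof -
  define S where "S = {x. diag x \<in> cylinder C V}"
  define b where "b = Inf S"
  obtain i where i: "i \<notin> V" using assms by blast
  obtain q where q: "\<forall>V. \<forall>l\<in>cylinder C V. \<forall>i. i \<notin> V \<longrightarrow> q $ i < l $ i"
    using cylinder_bounded_below by blast
  have bdd: "bdd_below S" by (rule bdd_belowI[of _ "q $ i"]) (use q i in \<open>force simp: S_def\<close>)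
  have ne: "S \<noteq> {}" using diag_in_cylinder by (auto simp: S_def)
  have up: "y \<in> S" if "x \<in> S" "x \<le> y" for x y
    using that cylinder_upward[of "diag x" V "diag y"] by (simp add: S_def)
  have pos: "D V (diag x) > 0" if "x \<in> S" for x using that cylinder_positive by (simp add: S_def)
  have above: "x \<in> S" if "b < x" for x
    using that up cInf_lessD[OF ne] unfolding b_def by (meson less_imp_le)
  have cont: "isCont (\<lambda>x. D V (diag x)) x" for x
    using DERIV_isCont[OF has_derivative_partial_deriv_diag[OF i]] .
  have bS: "b \<notin> S"
  proof
    assume "b \<in> S"
    then have "\<forall>\<^sub>F x in at b. D V (diag x) > 0"
      using pos cont[of b] by (intro order_tendstoD) (auto simp: isCont_def)
    then obtain e where e: "e > 0" "\<And>x. x \<noteq> b \<Longrightarrow> dist x b < e \<Longrightarrow> D V (diag x) > 0"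
      by (auto simp: eventually_at)
    have "D V (diag z) > 0" if "b - e / 2 \<le> z" "z \<le> b" for z
      using that e pos[OF \<open>b \<in> S\<close>] by (cases "z = b") (auto simp: dist_real_def)
    then have "b - e / 2 \<in> S"
      using diag_segment_in_cylinder[of b V "b - e / 2"] \<open>b \<in> S\<close> e(1) by (simp add: S_def)
    then show False using cInf_lower[OF _ bdd, of "b - e / 2"] e(1) by (simp add: b_def)
  qed
  have mem: "x \<in> S \<longleftrightarrow> b < x" for x
    using above bS up[of x b] by (meson not_le)
  have le: "D V (diag b) \<le> 0"
  proof (rule ccontr)
    assume *: "\<not> ?thesis"
    have "diag b \<in> cylinder C V"
    proof (rule diag_segment_in_cylinder[of "b + 1"])
      show "diag (b + 1) \<in> cylinder C V" using mem[of "b + 1"] by (simp add: S_def)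
      show "D V (diag z) > 0" if "b \<le> z" for z
        using * that pos[of z] mem[of z] by (cases "z = b") auto
    qed simp
    then show False using bS by (simp add: S_def)
  qed
  have "((\<lambda>x. D V (diag x)) \<longlongrightarrow> D V (diag b)) (at_right b)"
    using cont[of b] unfolding isCont_def by (rule filterlim_mono) (auto simp: at_le)
  then have "D V (diag b) \<ge> 0"
    by (rule tendsto_lowerbound)
      (auto simp: eventually_at_right_field intro!: exI[of _ "b + 1"] less_imp_le pos above)
  with le have zero: "D V (diag b) = 0" by simp
  obtain r where r: "r > 0" "(deriv ^^ card V) (diag_restriction (inverse_sigma_poly c :: real ^ 'n \<Rightarrow> real))
    = (\<lambda>x. r * D V (diag x))" using higher_deriv_diag_restriction by blast
  have "a = b" unfolding a_def largest_root_def r(2)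
  proof (rule Greatest_equality)
    show "r * D V (diag b) = 0" using zero by simp
    show "y \<le> b" if "r * D V (diag y) = 0" for y
      using that r(1) pos[of y] mem[of y] by (cases "b < y") auto
  qed
  then show "diag x \<in> cylinder C V \<longleftrightarrow> a < x" "D V (diag a) = 0"
    using mem zero by (auto simp: S_def)
qed

end

section \<open>Comparison of two stable components\<close>

text \<open>In the plane of the coordinates \<open>i\<close> and \<open>j\<close> the equation \<open>f\<^sub>V = 0\<close> is a hyperbola with asymptotes at
  \<open>- b\<close>, and \<open>g\<^sub>V\<close> has asymptotes at \<open>- b'\<close>.  The inclusion for \<open>insert j V\<close> says that
  \<open>- b \<le> - b'\<close>.  On the hyperbola the product of the two coordinates is an affine function of their
  sum, so \<open>g\<^sub>V\<close> is affine in the sum too, and \<open>b' \<le> b\<close> makes it nonincreasing.  Decreasing the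
  sum is thus harmless for \<open>g\<^sub>V\<close>.\<close>

lemma averaging_step:
  fixes l :: "real ^ 'n"
  assumes F: "stable_component c Cf" and G: "stable_component d Cg"
    and sub: "\<And>W. V \<subset> W \<Longrightarrow> cylinder Cg W \<subseteq> cylinder Cf W"
    and ij: "i \<noteq> j" "i \<notin> V" "j \<notin> V"
    and l: "l \<in> cylinder Cg V" and zero: "partial_deriv c V l = 0" and less: "l $ i < l $ j"
  obtains x y where "x + y < 0" "l + x *\<^sub>R axis i 1 + y *\<^sub>R axis j 1 \<in> cylinder Cg V"
    "partial_deriv c V (l + x *\<^sub>R axis i 1 + y *\<^sub>R axis j 1) = 0"
    "partial_deriv d V l \<le> partial_deriv d V (l + x *\<^sub>R axis i 1 + y *\<^sub>R axis j 1)"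
proof -
  interpret F: stable_component c Cf by fact
  interpret G: stable_component d Cg by fact
  let ?W = "insert i (insert j V)"
  have lg: "l \<in> cylinder Cg U" if "V \<subseteq> U" for U using l cylinder_mono[OF that, of Cg] by blast
  have lf: "l \<in> cylinder Cf U" if "V \<subset> U" for U using that sub lg by blast
  define a where "a = F.D ?W l"
  define a' where "a' = G.D ?W l"
  have a: "a > 0" "a' > 0"
    using F.cylinder_positive[OF lf, of ?W] G.cylinder_positive[OF lg, of ?W] ij
    by (auto simp: a_def a'_def)
  define b where "b = F.D (insert j V) l / a - l $ i"
  define b' where "b' = G.D (insert j V) l / a' - l $ i"
  define u where "u = l $ i + b"
  define v where "v = l $ j + b"
  have Fj: "F.D (insert j V) l = a * u" using a by (simp add: b_def u_def)
  have Gj: "G.D (insert j V) l = a' * (l $ i + b')" using a by (simp add: b'_def)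
  have Fi: "F.D (insert i V) l = a * v"
    using partial_deriv_swap[OF ij, of c l] Fj unfolding a_def[symmetric] u_def v_def
    by (simp add: algebra_simps)
  have Gi: "G.D (insert i V) l = a' * (l $ j + b')"
    using partial_deriv_swap[OF ij, of d l] Gj unfolding a'_def[symmetric]
    by (simp add: algebra_simps)
  have "a * u > 0" using F.cylinder_positive[OF lf, of "insert j V"] ij Fj by auto
  then have u: "u > 0" using a by (simp add: zero_less_mult_iff)
  have uv: "u < v" using less by (simp add: u_def v_def)
  \<comment> \<open>Otherwise moving coordinate \<open>i\<close> down to \<open>- b\<close>, where the derivative of \<open>f\<^sub>V\<close> in \<open>j\<close> vanishes,
    would stay in the cylinder of \<open>g\<close> over \<open>insert j V\<close>.\<close>
  have bb: "b' \<le> b"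
  proof (rule ccontr)
    assume "\<not> b' \<le> b"
    define m where "m = l + (- u) *\<^sub>R axis i 1"
    have i: "i \<notin> insert j V" using ij by simp
    have Gl: "a' * (l $ i + b') > 0" using G.cylinder_positive[OF lg, of "insert j V"] Gj by auto
    have Gm: "a' * (b' - b) > 0" using a \<open>\<not> b' \<le> b\<close> by simp
    have "m \<in> cylinder Cg (insert j V)"
    proof (rule G.segment_in_cylinder[OF lg])
      fix x assume "x \<in> closed_segment l m"
      then obtain t where t: "0 \<le> t" "t \<le> 1" "x = l + (t * - u) *\<^sub>R axis i 1"
        by (auto simp: in_segment m_def algebra_simps)
      have "G.D (insert j V) x = (1 - t) * (a' * (l $ i + b')) + t * (a' * (b' - b))"
        unfolding t(3) partial_deriv_shift[OF i] Gj a'_def[symmetric] u_def by (simp add: algebra_simps)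
      also have "\<dots> > 0"
        using t Gl Gm by (cases "t = 0") (auto intro!: add_nonneg_pos)
      finally show "G.D (insert j V) x > 0" .
    qed blast
    then have "m \<in> cylinder Cf (insert j V)" using sub[of "insert j V"] ij by blast
    then have "F.D (insert j V) m > 0" by (rule F.cylinder_positive)
    moreover have "F.D (insert j V) m = 0"
      unfolding m_def partial_deriv_shift[OF i] Fj a_def[symmetric] by simp
    ultimately show False by simp
  qed
  \<comment> \<open>Measured from the asymptotes, \<open>(u, v)\<close> moves to the point of the hyperbola with the same
    product whose first coordinate is \<open>(u + v) / 2\<close>.\<close>
  define x where "x = (v - u) / 2"
  define y where "y = - (v * (v - u) / (u + v))"
  have x: "x > 0" using uv by (simp add: x_def)
  have y: "y < 0" using u uv by (simp add: y_def)
  have hyp: "x * v + y * u + x * y = 0"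
    using u uv by (simp add: x_def y_def field_simps)
  have "x + y = - ((v - u)\<^sup>2 / (2 * (u + v)))"
    using u uv by (simp add: x_def y_def field_simps power2_eq_square)
  moreover have "(v - u)\<^sup>2 / (2 * (u + v)) > 0" using u uv by simp
  ultimately have xy: "x + y < 0" by linarith
  \<comment> \<open>The segment between two points of a hyperbola branch runs above the branch, where \<open>g\<^sub>V\<close> is at
    least as large as on the branch at the same sum; so the straight segment can replace the arc.\<close>
  have grow: "G.D V l \<le> G.D V (l + (t * x) *\<^sub>R axis i 1 + (t * y) *\<^sub>R axis j 1)"
    if t: "0 \<le> t" "t \<le> 1" for t
  proof -
    have "x * (l $ j + b') + y * (l $ i + b') = (x * v + y * u + x * y) - x * y + (x + y) * (b' - b)"
      by (simp add: u_def v_def algebra_simps)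
    then have lin: "x * (l $ j + b') + y * (l $ i + b') = (x + y) * (b' - b) - x * y"
      by (simp add: hyp)
    have "G.D V (l + (t * x) *\<^sub>R axis i 1 + (t * y) *\<^sub>R axis j 1)
        = G.D V l + a' * (t * (x * (l $ j + b') + y * (l $ i + b')) + t * t * (x * y))"
      unfolding partial_deriv_shift2[OF ij] Gi Gj a'_def[symmetric] by (simp add: algebra_simps)
    also have "\<dots> = G.D V l + a' * (t * ((x + y) * (b' - b)) + (t * (1 - t)) * (- x * y))"
      unfolding lin by (simp add: algebra_simps)
    also have "\<dots> \<ge> G.D V l"
    proof -
      have "(x + y) * (b' - b) \<ge> 0" using xy bb by (intro mult_nonpos_nonpos) auto
      moreover have "- x * y \<ge> 0" using x y by (simp add: mult_nonneg_nonpos)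
      moreover have "0 \<le> a' * (t * p + t * (1 - t) * r)" if "0 \<le> p" "0 \<le> r" for p r
        using a t that by (intro mult_nonneg_nonneg add_nonneg_nonneg) auto
      ultimately show ?thesis by (metis le_add_same_cancel1)
    qed
    finally show ?thesis .
  qed
  show thesis
  proof
    show "x + y < 0" by fact
    have "F.D V (l + x *\<^sub>R axis i 1 + y *\<^sub>R axis j 1) = a * (x * v + y * u + x * y)"
      unfolding partial_deriv_shift2[OF ij] zero Fi Fj a_def[symmetric] by (simp add: algebra_simps)
    then show "F.D V (l + x *\<^sub>R axis i 1 + y *\<^sub>R axis j 1) = 0" by (simp add: hyp)
    show "G.D V l \<le> G.D V (l + x *\<^sub>R axis i 1 + y *\<^sub>R axis j 1)" using grow[of 1] by simp
    show "l + x *\<^sub>R axis i 1 + y *\<^sub>R axis j 1 \<in> cylinder Cg V"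
    proof (rule G.segment_in_cylinder[OF l])
      fix p assume "p \<in> closed_segment l (l + x *\<^sub>R axis i 1 + y *\<^sub>R axis j 1)"
      then obtain t where t: "0 \<le> t" "t \<le> 1"
          "p = (1 - t) *\<^sub>R l + t *\<^sub>R (l + x *\<^sub>R axis i 1 + y *\<^sub>R axis j 1)"
        unfolding in_segment by blast
      have "p = l + (t * x) *\<^sub>R axis i 1 + (t * y) *\<^sub>R axis j 1"
        unfolding t(3) by (simp add: vec_eq_iff algebra_simps)
      then show "G.D V p > 0" using grow[OF t(1,2)] G.cylinder_positive[OF l] by (metis less_le_trans)
    qed
  qed
qed

text \<open>The minimisation argument.  Bounding \<open>g\<^sub>V\<close> from below by a positive number keeps limits inside the
  cylinder of \<open>g\<close>; bounding the sum of the coordinates, and fixing the irrelevant ones in \<open>V\<close>,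
  gives compactness.\<close>

lemma cylinder_subset_step:
  fixes V :: "'n::finite set"
  assumes F: "stable_component c Cf" and G: "stable_component d Cg"
    and sub: "\<And>W. V \<subset> W \<Longrightarrow> cylinder Cg W \<subseteq> cylinder Cf W"
    and V: "V \<noteq> UNIV"
    and roots: "largest_root ((deriv ^^ card V) (diag_restriction (inverse_sigma_poly c :: real ^ 'n \<Rightarrow> real)))
      \<le> largest_root ((deriv ^^ card V) (diag_restriction (inverse_sigma_poly d :: real ^ 'n \<Rightarrow> real)))"
  shows "cylinder Cg V \<subseteq> cylinder Cf V"
proof (rule subsetI, rule ccontr)
  interpret F: stable_component c Cf by fact
  interpret G: stable_component d Cg by fact
  fix l0 assume l0: "l0 \<in> cylinder Cg V" "l0 \<notin> cylinder Cf V"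
  obtain i where i: "i \<notin> V" using V by blast
  have l0f: "l0 \<in> cylinder Cf (insert i V)"
    using l0(1) sub[of "insert i V"] cylinder_mono[of V "insert i V" Cg] i by blast
  then obtain z where z: "0 \<le> z" "l0 + z *\<^sub>R axis i 1 \<in> cylinder Cf V" by (rule F.cylinder_insert)
  have slope: "F.D (insert i V) l0 > 0" using l0f by (rule F.cylinder_positive)
  have neg: "F.D V l0 \<le> 0"
  proof (rule ccontr)
    assume *: "\<not> ?thesis"
    have "l0 \<in> cylinder Cf V"
    proof (rule F.segment_in_cylinder[OF z(2)])
      fix x assume "x \<in> closed_segment (l0 + z *\<^sub>R axis i 1) l0"
      then obtain t where t: "0 \<le> t" "t \<le> 1" "x = l0 + ((1 - t) * z) *\<^sub>R axis i 1"
        by (auto simp: in_segment algebra_simps)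
      show "F.D V x > 0"
        unfolding t(3) partial_deriv_shift[OF i] using * slope t z
        by (intro add_pos_nonneg mult_nonneg_nonneg) auto
    qed
    then show False using l0(2) by simp
  qed
  \<comment> \<open>Raise coordinate \<open>i\<close> to the zero of the affine function \<open>f\<^sub>V\<close> on that line.\<close>
  define l1 where "l1 = l0 + (- F.D V l0 / F.D (insert i V) l0) *\<^sub>R axis i 1"
  have "l1 \<in> cylinder Cg V"
    using neg slope unfolding l1_def
    by (intro G.cylinder_upward[OF l0(1)]) (simp add: axis_def divide_nonpos_pos)
  moreover have "F.D V l1 = 0"
    unfolding l1_def partial_deriv_shift[OF i] using slope by simp
  moreover define l2 where "l2 = (\<chi> k. if k \<in> V then 0 else l1 $ k)"
  ultimately have l2: "l2 \<in> cylinder Cg V" "F.D V l2 = 0"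
    using cylinder_cong[of l1 Cg V l2] partial_deriv_cong[of V l1 l2 c] by auto
  define e where "e = G.D V l2"
  have e: "e > 0" using G.cylinder_positive[OF l2(1)] by (simp add: e_def)
  define N where "N = {l. F.D V l = 0 \<and> e \<le> G.D V l \<and> (\<forall>v\<in>V. l $ v = 0)
    \<and> (\<Sum>k\<in>UNIV. l $ k) \<le> (\<Sum>k\<in>UNIV. l2 $ k)}"
  have "N = {l. F.D V l = 0} \<inter> {l. e \<le> G.D V l} \<inter> (\<Inter>v\<in>V. {l. l $ v = 0})
      \<inter> {l. (\<Sum>k\<in>UNIV. l $ k) \<le> (\<Sum>k\<in>UNIV. l2 $ k)}"
    by (auto simp: N_def)
  also have "closed \<dots>"
    by (intro closed_Int closed_INT ballI closed_Collect_eq closed_Collect_le continuous_intros)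
  finally have "closed (N \<inter> cylinder Cg V)"
    using e by (intro G.closed_Int_cylinder) (auto simp: N_def)
  moreover have "bounded (N \<inter> cylinder Cg V)"
  proof -
    obtain q where q: "\<forall>V. \<forall>l\<in>cylinder Cg V. \<forall>i. i \<notin> V \<longrightarrow> q $ i < l $ i"
      using G.cylinder_bounded_below by blast
    define Q where "Q = (\<Sum>k\<in>UNIV. \<bar>q $ k\<bar>)"
    have qQ: "\<bar>q $ k\<bar> \<le> Q" for k unfolding Q_def by (rule member_le_sum) auto
    define R where "R = (\<Sum>k\<in>UNIV. l2 $ k) + real CARD('n) * Q"
    have "l \<in> cbox (diag (- Q)) (diag R)" if l: "l \<in> N \<inter> cylinder Cg V" for l
    proof -
      have low: "- Q \<le> l $ k" for k
      proof (cases "k \<in> V")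
        case True
        then show ?thesis using l qQ[of k] by (simp add: N_def)
      next
        case False
        then have "q $ k < l $ k" using q l by blast
        then show ?thesis using qQ[of k] by linarith
      qed
      have nonneg: "0 \<le> l $ k + Q" for k using low[of k] by linarith
      have "l $ k \<le> R" for k
      proof -
        have "l $ k + Q \<le> (\<Sum>k\<in>UNIV. l $ k + Q)"
          using nonneg by (intro member_le_sum) auto
        also have "\<dots> \<le> R" using l by (simp add: sum.distrib R_def N_def)
        finally show ?thesis using qQ[of k] by linarith
      qed
      with low show ?thesis by (simp add: mem_box_cart)
    qed
    then show ?thesis by (meson bounded_cbox bounded_subset subsetI)
  qed
  ultimately have "compact (N \<inter> cylinder Cg V)" by (simp add: compact_eq_bounded_closed)
  moreover have "N \<inter> cylinder Cg V \<noteq> {}" using l2 by (auto simp: N_def e_def l2_def)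
  moreover have "continuous_on (N \<inter> cylinder Cg V) (\<lambda>l. \<Sum>k\<in>UNIV. l $ k)"
    by (intro continuous_intros)
  ultimately obtain m where m: "m \<in> N" "m \<in> cylinder Cg V"
      and least: "\<And>l. l \<in> N \<Longrightarrow> l \<in> cylinder Cg V \<Longrightarrow> (\<Sum>k\<in>UNIV. m $ k) \<le> (\<Sum>k\<in>UNIV. l $ k)"
    using continuous_attains_inf[of "N \<inter> cylinder Cg V" "\<lambda>l. \<Sum>k\<in>UNIV. l $ k"] by blast
  have ge: "m $ k \<le> m $ j" if V: "j \<notin> V" "k \<notin> V" for j k
  proof (rule ccontr)
    assume "\<not> ?thesis"
    then have jk: "m $ j < m $ k" "j \<noteq> k" by auto
    have zero: "F.D V m = 0" using m by (simp add: N_def)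
    obtain x y where xy: "x + y < 0" "m + x *\<^sub>R axis j 1 + y *\<^sub>R axis k 1 \<in> cylinder Cg V"
      "F.D V (m + x *\<^sub>R axis j 1 + y *\<^sub>R axis k 1) = 0"
      "G.D V m \<le> G.D V (m + x *\<^sub>R axis j 1 + y *\<^sub>R axis k 1)"
      by (rule averaging_step[OF F G sub jk(2) V m(2) zero jk(1)])
    have "(\<Sum>h\<in>UNIV. (m + x *\<^sub>R axis j 1 + y *\<^sub>R axis k 1) $ h)
        = (\<Sum>h\<in>UNIV. m $ h + (if h = j then x else 0) + (if h = k then y else 0))"
      by (intro sum.cong) (auto simp: axis_def)
    then have s: "(\<Sum>h\<in>UNIV. (m + x *\<^sub>R axis j 1 + y *\<^sub>R axis k 1) $ h) = (\<Sum>h\<in>UNIV. m $ h) + (x + y)"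
      by (simp add: sum.distrib)
    have "m + x *\<^sub>R axis j 1 + y *\<^sub>R axis k 1 \<in> N"
      unfolding N_def mem_Collect_eq s using m(1) xy V
      by (auto simp: N_def axis_def)
    from least[OF this xy(2)] show False unfolding s using xy(1) by simp
  qed
  have flat: "m $ k = diag (m $ i) $ k" if "k \<notin> V" for k
    using ge[OF i that] ge[OF that i] by simp
  have "diag (m $ i) \<in> cylinder Cg V" using m(2) flat by (rule cylinder_cong)
  then have "diag (m $ i) \<in> cylinder Cf V"
    using roots F.largest_root_threshold(1)[OF V] G.largest_root_threshold(1)[OF V] by fastforce
  then have "F.D V (diag (m $ i)) > 0" by (rule F.cylinder_positive)
  moreover have "F.D V (diag (m $ i)) = F.D V m" by (rule partial_deriv_cong) (simp add: flat)
  ultimately show False using m(1) by (simp add: N_def)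
qed

theorem theorem1p3:
  fixes c d :: "nat \<Rightarrow> real"
    and f g :: "real ^ 'n \<Rightarrow> real"
    and Gf Gg :: "(real ^ 'n) set"
  assumes "f = inverse_sigma_poly c"
    and "g = inverse_sigma_poly d"
    and "upsilon_stable_component f Gf"
    and "upsilon_stable_component g Gg"
  shows "dominates g f \<longleftrightarrow> Gg \<subseteq> Gf"
proof -
  have F: "stable_component c Gf" and G: "stable_component d Gg"
    using assms by (simp_all add: stable_component_def)
  interpret F: stable_component c Gf by fact
  interpret G: stable_component d Gg by fact
  show ?thesis
  proof
    assume dom: "dominates g f"
    have "cylinder Gg V \<subseteq> cylinder Gf V" for V
    proof (induction "card (- V)" arbitrary: V rule: less_induct)
      case less
      show ?case
      proof (cases "V = UNIV")
        case True
        then show ?thesis by (simp add: F.cylinder_UNIV)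
      next
        case False
        have IH: "cylinder Gg W \<subseteq> cylinder Gf W" if "V \<subset> W" for W
        proof (rule less)
          have "- W \<subset> - V" using that by blast
          then show "card (- W) < card (- V)" by (intro psubset_card_mono) simp_all
        qed
        have "card V < CARD('n)" using False psubset_card_mono[of UNIV V] by auto
        with dom have "largest_root ((deriv ^^ card V) (diag_restriction f))
            \<le> largest_root ((deriv ^^ card V) (diag_restriction g))"
          by (simp add: dominates_def)
        with IH False show ?thesis
          unfolding assms(1,2) by (rule cylinder_subset_step[OF F G])
      qed
    qed
    from this[of "{}"] show "Gg \<subseteq> Gf" by simp
  next
    assume sub: "Gg \<subseteq> Gf"
    show "dominates g f"
      unfolding dominates_def
    proof (intro allI impI)
      fix k assume k: "k < CARD('n)"
      then obtain V :: "'n set" where V: "card V = k"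
        using obtain_subset_with_card_n[of k "UNIV :: 'n set"] by (meson less_imp_le)
      then have VU: "V \<noteq> UNIV" using k by auto
      have "cylinder Gg V \<subseteq> cylinder Gf V" using sub by (auto simp: cylinder_def)
      then have "largest_root ((deriv ^^ k) (diag_restriction f)) \<le> x"
        if "largest_root ((deriv ^^ k) (diag_restriction g)) < x" for x
        using that F.largest_root_threshold(1)[OF VU, of x] G.largest_root_threshold(1)[OF VU, of x]
        unfolding assms(1,2) V by (meson less_imp_le subsetD)
      then show "largest_root ((deriv ^^ k) (diag_restriction f)) \<le> largest_root ((deriv ^^ k) (diag_restriction g))"
        by (rule dense_ge)
    qed
  qed
qed

end
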